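(* Let $M_n=\{(n-k,1^k):0\le k\le n-1\}$ be the main chain of the partition graph $G_n$. For every integer $n\ge 2$, the vertices of $M_n$, taken in their natural order $(n),(n-1,1),(n-2,1^2),\dots,(2,1^{n-2}),(1^n)$, form a shortest path in $G_n$ between the two antenna vertices $(n)$ and $(1^n)$. For $n=1$, $M_n$ consists of the single vertex $(1)$.
   Context: A partition of a positive integer $n$ is a finite weakly decreasing sequence $\lambda=(\lambda_1,\dots,\lambda_\ell)$ of positive integers with sum $n$ (written $\lambda\vdash n$); partitions are identified with their Ferrers diagrams. Exponents denote repeated parts, so $(n-k,1^k)$ is the hook partition with first part $n-k$ followed by $k$ parts equal to $1$ (for $k=0$ it is $(n)$, for $k=n-1$ it is $(1^n)$). The partition graph $G_n$ is the simple graph whose vertices are the partitions of $n$; two distinct partitions are adjacent if and only if one is obtained from the other by an elementary transfer of one cell of the Ferrers diagram (moving a cell from a removable corner to an addable corner, followed by reordering, with the result different from the original partition). Equivalently: one decreases one part by $1$ and increases another part by $1$, where the increased part may also be a new part of length $0$ (thus creating a new part $1$), deletes any part that became $0$, sorts into weakly decreasing order, and requires that the resulting partition differ from the original. The antenna vertices of $G_n$ are $(n)$ and $(1^n)$. A shortest path between two vertices is a path whose number of edges equals their graph distance. *)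

theory Defs
  imports "Graph_Theory.Graph_Theory"
begin

definition is_partition :: "nat \<Rightarrow> nat list \<Rightarrow> bool" where
  "is_partition n xs \<longleftrightarrow> sorted_wrt (\<ge>) xs \<and> 0 \<notin> set xs \<and> sum_list xs = n"

text \<open>
  The appended 0 is the empty row below the Ferrers diagram: increasing it creates a new part 1.
  The donor \<open>i\<close> ranges over the genuine rows only. The donor row need not end in a removable
  corner, nor the receiving row in an addable one: a choice of rows within blocks of equal
  parts is immaterial, since the result is sorted.
\<close>

definition transfer :: "nat list \<Rightarrow> nat \<Rightarrow> nat \<Rightarrow> nat list" where
  "transfer xs i j =
     (let ys = xs @ [0]
      in rev (sort (filter (\<lambda>p. p \<noteq> 0) (ys[i := ys ! i - 1, j := ys ! j + 1]))))"

definition elementary_transfer :: "nat list \<Rightarrow> nat list \<Rightarrow> bool" where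
  "elementary_transfer xs ys \<longleftrightarrow>
     (\<exists>i j. i < length xs \<and> j \<le> length xs \<and> i \<noteq> j \<and> ys = transfer xs i j)"

text \<open>The simple graph is represented by its symmetric digraph (both orientations of each edge).\<close>

definition partition_graph :: "nat \<Rightarrow> nat list pair_pre_digraph" where
  "partition_graph n =
     \<lparr> pverts = {xs. is_partition n xs},
       parcs = {(xs, ys). is_partition n xs \<and> is_partition n ys \<and> xs \<noteq> ys \<and>
                  (elementary_transfer xs ys \<or> elementary_transfer ys xs)} \<rparr>"

lemma finite_partitions: "finite {xs. is_partition n xs}"
proof (rule finite_subset)
  have "length xs \<le> sum_list xs" if "0 \<notin> set xs" for xs :: "nat list"
    using that by (induction xs) auto
  then show "{xs. is_partition n xs} \<subseteq> {xs. set xs \<subseteq> {..n} \<and> length xs \<le> n}"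
    by (auto simp: is_partition_def dest: member_le_sum_list)
  show "finite {xs. set xs \<subseteq> {..n} \<and> length xs \<le> n}"
    by (rule finite_lists_length_le) simp
qed

lemma pair_graph_partition_graph: "pair_graph (partition_graph n)"
proof -
  have "finite (parcs (partition_graph n))"
    by (rule finite_subset[OF _ finite_cartesian_product[OF finite_partitions finite_partitions]])
       (auto simp: partition_graph_def)
  then show ?thesis
    by unfold_locales
       (auto simp: partition_graph_def finite_partitions symmetric_def sym_def arcs_ends_conv)
qed

text \<open>
  \<open>wf_digraph.\<mu> G (\<lambda>_. 1) u v\<close> is the infimum of the numbers of arcs of walks from \<open>u\<close> to \<open>v\<close>,
  i.e. the graph distance.
\<close>

definition is_shortest_path :: "('a, 'b) pre_digraph \<Rightarrow> 'a \<Rightarrow> 'a list \<Rightarrow> 'a \<Rightarrow> bool" where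
  "is_shortest_path G u p v \<longleftrightarrow>
     vpath p G \<and> hd p = u \<and> last p = v \<and>
     ereal (real (vwalk_length p)) = wf_digraph.\<mu> G (\<lambda>_. 1) u v"

definition hook :: "nat \<Rightarrow> nat \<Rightarrow> nat list" where
  "hook n k = (n - k) # replicate k 1"

definition main_chain :: "nat \<Rightarrow> nat list set" where
  "main_chain n = {hook n k | k. k < n}"

definition main_chain_seq :: "nat \<Rightarrow> nat list list" where
  "main_chain_seq n = map (hook n) [0..<n]"

end

theory Submission
  imports Defs
begin

text \<open>
  Consecutive hooks \<open>hook n k\<close> and \<open>hook n (Suc k)\<close> are adjacent, since a cell of the first row
  can be moved into the empty row at the bottom; so the main chain is a path with \<open>n - 1\<close> edges
  (\<open>main_chain_vpath\<close>). It is shortest because the number of parts is a potential for the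
  partition graph: one transfer changes it by at most one (\<open>length_adjacent_partitions\<close>), while
  it has to grow from 1 at \<open>(n)\<close> to \<open>n\<close> at \<open>(1\<^sup>n)\<close>. The passage from such a potential to
  the graph distance is \<open>shortest_path_by_potential\<close>.
\<close>

section \<open>Shortest paths certified by a potential\<close>

lemma (in wf_digraph) awalk_of_vwalk:
  assumes "vwalk p G"
  shows "\<exists>q. awalk (hd p) q (last p) \<and> length q = vwalk_length p"
  using assms
proof (induction p rule: vwalk_induct)
  case (Base u)
  then show ?case by (auto simp: awalk_Nil_iff)
next
  case (Cons u v es)
  then obtain q e where q: "awalk v q (last (v # es))" "length q = length es"
    and e: "e \<in> arcs G" "tail G e = u" "head G e = v"
    by (auto simp: arcs_ends_conv)
  then have "awalk u (e # q) (last (u # v # es))"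
    by (simp add: awalk_Cons_iff)
  with q show ?case by (intro exI[of _ "e # q"]) simp
qed

lemma (in wf_digraph) awalk_cost_unit: "awalk_cost (\<lambda>_. 1) p = real (length p)"
  by (induction p) simp_all

lemma (in wf_digraph) potential_difference_le_length:
  fixes f :: "'a \<Rightarrow> nat"
  assumes "awalk u p v"
    and "\<And>x y. (x, y) \<in> arcs_ends G \<Longrightarrow> f y \<le> f x + 1"
  shows "f v \<le> f u + length p"
  using assms(1)
proof (induction p arbitrary: u)
  case Nil
  then show ?case by (simp add: awalk_Nil_iff)
next
  case (Cons e p)
  then have "e \<in> arcs G" "tail G e = u" "f v \<le> f (head G e) + length p"
    by (auto simp: awalk_Cons_iff)
  moreover have "f (head G e) \<le> f (tail G e) + 1"
    using \<open>e \<in> arcs G\<close> by (intro assms(2)) (auto simp: arcs_ends_conv)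
  ultimately show ?case by simp
qed

text \<open>
  The path itself bounds the distance from above. From below, a walk can raise the potential by
  at most its length, so no walk is shorter than the total rise, which the path attains.
\<close>

lemma (in wf_digraph) shortest_path_by_potential:
  fixes f :: "'a \<Rightarrow> nat"
  assumes path: "vpath p G" "hd p = u" "last p = v"
    and step: "\<And>x y. (x, y) \<in> arcs_ends G \<Longrightarrow> f y \<le> f x + 1"
    and tight: "f v = f u + vwalk_length p"
  shows "is_shortest_path G u p v"
proof -
  obtain q where q: "awalk u q v" "length q = vwalk_length p"
    using awalk_of_vwalk[of p] path by auto
  have "ereal (real (vwalk_length p)) \<le> \<mu> (\<lambda>_. 1) u v"
    unfolding \<mu>_def
  proof (rule INF_greatest)
    fix r assume "r \<in> {r. awalk u r v}"
    then have "f v \<le> f u + length r"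
      using potential_difference_le_length[OF _ step] by simp
    with tight show "ereal (real (vwalk_length p)) \<le> ereal (awalk_cost (\<lambda>_. 1) r)"
      by (simp add: awalk_cost_unit)
  qed
  moreover have "\<mu> (\<lambda>_. 1) u v \<le> ereal (real (vwalk_length p))"
    using min_cost_le_walk_cost[OF q(1), of "\<lambda>_. 1"] q(2) by (simp add: awalk_cost_unit)
  ultimately show ?thesis
    using path by (simp add: is_shortest_path_def)
qed

section \<open>The number of parts along an edge\<close>

lemma length_filter_list_update_le:
  "length (filter P (xs[i := x])) \<le> length (filter P xs) + 1"
  by (induction xs arbitrary: i) (auto split: nat.split)

lemma length_filter_le_list_update:
  "length (filter P xs) \<le> length (filter P (xs[i := x])) + 1"
  by (induction xs arbitrary: i) (auto split: nat.split)

lemma length_filter_list_update_mono: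
  assumes "P (xs ! i) \<Longrightarrow> P x"
  shows "length (filter P xs) \<le> length (filter P (xs[i := x]))"
  using assms by (induction xs arbitrary: i) (auto split: nat.split)

lemma length_filter_list_update_antimono:
  assumes "i < length xs" "P x \<Longrightarrow> P (xs ! i)"
  shows "length (filter P (xs[i := x])) \<le> length (filter P xs)"
  using assms by (induction xs arbitrary: i) (auto split: nat.split)

text \<open>
  The two halves of a transfer act in opposite directions: taking a cell away can only destroy a
  part, adding one can only create a part, and each affects a single row.
\<close>

lemma length_transfer:
  assumes "0 \<notin> set xs" "i < length xs" "i \<noteq> j"
  shows "length (transfer xs i j) \<le> length xs + 1" "length xs \<le> length (transfer xs i j) + 1"
proof -
  define ys where "ys = xs @ [0]"
  define zs where "zs = ys[i := ys ! i - 1]"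
  let ?parts = "\<lambda>us :: nat list. length (filter (\<lambda>p. p \<noteq> 0) us)"
  have *: "length (transfer xs i j) = ?parts (zs[j := ys ! j + 1])"
    by (simp add: transfer_def Let_def ys_def zs_def)
  have "filter (\<lambda>p. p \<noteq> 0) xs = xs"
    using assms(1) by (metis (mono_tags, lifting) filter_True)
  then have ys: "?parts ys = length xs"
    by (simp add: ys_def)
  have "?parts zs \<le> ?parts ys"
    using assms(2) unfolding zs_def
    by (intro length_filter_list_update_antimono) (auto simp: ys_def)
  moreover have "?parts (zs[j := ys ! j + 1]) \<le> ?parts zs + 1"
    by (rule length_filter_list_update_le)
  ultimately show "length (transfer xs i j) \<le> length xs + 1"
    by (simp only: * ys)
  have "?parts ys \<le> ?parts zs + 1"
    unfolding zs_def by (rule length_filter_le_list_update)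
  moreover have "?parts zs \<le> ?parts (zs[j := ys ! j + 1])"
    by (rule length_filter_list_update_mono) simp
  ultimately show "length xs \<le> length (transfer xs i j) + 1"
    by (simp only: * ys)
qed

text \<open>
  An edge may be the reversal of a transfer, so both bounds on the length of a transfer are used.
\<close>

lemma length_adjacent_partitions:
  assumes "(xs, ys) \<in> parcs (partition_graph n)"
  shows "length ys \<le> length xs + 1"
  using assms length_transfer
  by (fastforce simp: partition_graph_def is_partition_def elementary_transfer_def)

section \<open>The main chain\<close>

lemma is_partition_hook:
  assumes "k < n"
  shows "is_partition n (hook n k)"
  using assms by (induction k) (auto simp: is_partition_def hook_def sum_list_replicate)

lemma length_hook: "length (hook n k) = k + 1"
  by (simp add: hook_def)

lemma rev_sort_of_decreasing:
  assumes "sorted_wrt (\<ge>) (xs :: 'a :: linorder list)"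
  shows "rev (sort xs) = xs"
proof -
  have "sorted (rev xs)"
    using assms by (simp add: sorted_wrt_rev)
  then have "sort xs = rev xs"
    by (intro properties_for_sort) simp_all
  then show ?thesis by simp
qed

lemma transfer_hook:
  assumes "Suc k < n"
  shows "transfer (hook n k) 0 (Suc k) = hook n (Suc k)"
proof -
  have hook: "is_partition n (hook n (Suc k))"
    using assms by (rule is_partition_hook)
  have "(hook n k @ [0])[0 := (hook n k @ [0]) ! 0 - 1, Suc k := (hook n k @ [0]) ! Suc k + 1]
      = hook n (Suc k)"
    by (simp add: hook_def nth_append list_update_append replicate_append_same)
  moreover have "filter (\<lambda>p. p \<noteq> 0) (hook n (Suc k)) = hook n (Suc k)"
    using hook by (metis (mono_tags, lifting) filter_True is_partition_def)
  ultimately show ?thesis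
    using hook unfolding transfer_def Let_def
    by (simp only: is_partition_def rev_sort_of_decreasing)
qed

lemma hook_adjacent:
  assumes "Suc k < n"
  shows "(hook n k, hook n (Suc k)) \<in> parcs (partition_graph n)"
proof -
  have "elementary_transfer (hook n k) (hook n (Suc k))"
    unfolding elementary_transfer_def transfer_hook[OF assms, symmetric]
    by (intro exI[of _ 0] exI[of _ "Suc k"]) (simp add: length_hook)
  moreover have "hook n k \<noteq> hook n (Suc k)"
    using length_hook by (metis add_right_cancel n_not_Suc_n)
  ultimately show ?thesis
    using assms by (simp add: partition_graph_def is_partition_hook)
qed

lemma vwalk_arcs_map_upt:
  "set (vwalk_arcs (map f [0..<n])) = {(f k, f (Suc k)) | k. Suc k < n}"
proof (induction n)
  case (Suc n)
  show ?case
  proof (cases "n = 0")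
    case False
    then have "set (vwalk_arcs (map f [0..<n] @ [f n])) =
        insert (f (n - 1), f n) (set (vwalk_arcs (map f [0..<n])))"
      by (subst set_vwalk_arcs_snoc) (auto simp: last_map)
    also have "\<dots> = {(f k, f (Suc k)) | k. Suc k < Suc n}"
      using False by (auto simp: Suc less_Suc_eq intro: exI[of _ "n - 1"])
    finally show ?thesis by simp
  qed simp
qed simp

lemma main_chain_vpath:
  assumes "n \<ge> 1"
  shows "vpath (main_chain_seq n) (with_proj (partition_graph n))"
proof (intro vpathI vwalkI)
  show "set (main_chain_seq n) \<subseteq> verts (with_proj (partition_graph n))"
    by (auto simp: main_chain_seq_def partition_graph_def is_partition_hook)
  show "set (vwalk_arcs (main_chain_seq n)) \<subseteq> arcs_ends (with_proj (partition_graph n))"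
    using hook_adjacent by (auto simp: main_chain_seq_def vwalk_arcs_map_upt)
  show "main_chain_seq n \<noteq> []"
    using assms by (simp add: main_chain_seq_def)
  have "inj (hook n)"
    by (rule injI) (metis length_hook add_right_cancel)
  then show "distinct (main_chain_seq n)"
    by (auto simp: main_chain_seq_def distinct_map intro: inj_on_subset)
qed

lemma main_chain_endpoints:
  assumes "n \<ge> 1"
  shows "hd (main_chain_seq n) = [n]" "last (main_chain_seq n) = replicate n 1"
proof -
  show "hd (main_chain_seq n) = [n]"
    using assms by (simp add: main_chain_seq_def hd_map hook_def)
  have "last (main_chain_seq n) = hook n (n - 1)"
    using assms by (simp add: main_chain_seq_def last_map)
  also have "\<dots> = replicate n 1"
    using assms by (cases n) (auto simp: hook_def)
  finally show "last (main_chain_seq n) = replicate n 1" .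
qed

lemma main_chain_shortest_path:
  assumes "n \<ge> 1"
  shows "is_shortest_path (with_proj (partition_graph n)) [n] (main_chain_seq n) (replicate n 1)"
proof -
  interpret pair_graph "partition_graph n"
    by (rule pair_graph_partition_graph)
  show ?thesis
  proof (rule shortest_path_by_potential[where f = length])
    show "length y \<le> length x + 1" if "(x, y) \<in> parcs (partition_graph n)" for x y
      using that by (rule length_adjacent_partitions)
    show "length (replicate n (1 :: nat)) = length [n] + vwalk_length (main_chain_seq n)"
      using assms by (simp add: main_chain_seq_def)
  qed (use assms in \<open>simp_all add: main_chain_vpath main_chain_endpoints\<close>)
qed

theorem proposition2p5:
  shows "(\<forall>n\<ge>2. set (main_chain_seq n) = main_chain n \<and>
            is_shortest_path (with_proj (partition_graph n)) [n] (main_chain_seq n) (replicate n 1)) \<and>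
         main_chain 1 = {[1]} \<and> [1] \<in> pverts (partition_graph 1)"
proof (intro conjI allI impI)
  fix n :: nat
  assume "n \<ge> 2"
  then show "is_shortest_path (with_proj (partition_graph n)) [n] (main_chain_seq n) (replicate n 1)"
    by (intro main_chain_shortest_path) simp
  show "set (main_chain_seq n) = main_chain n"
    by (auto simp: main_chain_seq_def main_chain_def)
next
  show "main_chain 1 = {[1]}"
    by (auto simp: main_chain_def hook_def)
  show "[1] \<in> pverts (partition_graph 1)"
    by (simp add: partition_graph_def is_partition_def)
qed

end
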